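(* For every $n\ge 2$, $$|D_n| = \left\lfloor \tfrac{n}{2}\right\rfloor + \left\lfloor \tfrac{n-1}{2}\right\rfloor = n-1.$$
   Context: $S_n$ is the set of permutations of $\{1,\dots,n\}$ written in one-line notation. A permutation $\pi\in S_n$ avoids $132$ if there are no indices $i<j<k$ with $\pi_i<\pi_k<\pi_j$. Let $\mathcal{A}^{(2)}_n$ be the set of $\pi\in S_n$ that avoid $132$ and satisfy $|\pi_{i+1}-\pi_i|\le 2$ for all $1\le i<n$. Define $D_n=\{\pi\in\mathcal{A}^{(2)}_n : \pi_n=n\}$. *)

theory Defs
  imports Complex_Main "HOL-Combinatorics.Permutations"
begin

text \<open>
  A permutation in \<open>S\<^sub>n\<close> is a function \<open>p\<close> with \<open>p permutes {1..n}\<close>; its one-line notation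
  is \<open>p 1, \<dots>, p n\<close>. Since such a \<open>p\<close> is the identity outside \<open>{1..n}\<close>, distinct functions
  correspond to distinct one-line words, so \<^const>\<open>card\<close> counts permutations.
\<close>

definition avoids_132 :: "nat \<Rightarrow> (nat \<Rightarrow> nat) \<Rightarrow> bool" where
  "avoids_132 n p \<longleftrightarrow>
     \<not> (\<exists>i j k. 1 \<le> i \<and> i < j \<and> j < k \<and> k \<le> n \<and> p i < p k \<and> p k < p j)"

definition A2 :: "nat \<Rightarrow> (nat \<Rightarrow> nat) set" where
  "A2 n = {p. p permutes {1..n} \<and> avoids_132 n p \<and>
              (\<forall>i. 1 \<le> i \<and> i < n \<longrightarrow> \<bar>int (p (i + 1)) - int (p i)\<bar> \<le> 2)}"

definition D :: "nat \<Rightarrow> (nat \<Rightarrow> nat) set" where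
  "D n = {p \<in> A2 n. p n = n}"

end

theory Submission
  imports Defs
begin

text \<open>
  If \<open>p\<close> avoids \<open>132\<close> and \<open>p m = m - 1\<close> with \<open>m \<ge> 2\<close>, then \<open>p 1 = m\<close>; the condition on
  adjacent entries then forces, alternately from both ends, the single word
  \<open>m, m - 2, m - 4, \<dots>, m - 3, m - 1\<close>. An element of \<open>D n\<close> has \<open>p n = n\<close>, so
  \<open>p (n - 1)\<close> is \<open>n - 1\<close> or \<open>n - 2\<close>. Going down from \<open>n\<close> in this way, \<open>p\<close> consists of such a
  word for some \<open>m < n\<close>, followed by \<open>m + 1, \<dots>, n\<close>. The words are told apart by \<open>p 1 = m\<close>.
\<close>

text \<open>Being the identity beyond \<open>m\<close>, one function supplies the word and the tail
  \<open>m + 1\<close>, ..., \<open>n\<close> for every \<open>n\<close> > \<open>m\<close> at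
  once.\<close>

definition valley :: "nat \<Rightarrow> nat \<Rightarrow> nat" where
  "valley m i = (if i = 0 \<or> m < i then i
                 else if 2 * i \<le> m + 1 then m + 2 - 2 * i else 2 * i - m - 1)"

lemma valley_1: "1 \<le> m \<Longrightarrow> valley m 1 = m"
  by (auto simp: valley_def)

lemma valley_permutes:
  assumes "m \<le> n"
  shows "valley m permutes {1..n}"
proof (rule bij_imp_permutes)
  \<comment> \<open>The descending half takes values of the parity of \<open>m\<close>, the
    ascending half the others, so the halves never collide.\<close>
  have inj: "inj_on (valley m) {1..n}"
    by (rule inj_onI) (auto simp: valley_def split: if_splits; presburger)
  have "valley m ` {1..n} \<subseteq> {1..n}"
    using assms by (auto simp: valley_def)
  then have "valley m ` {1..n} = {1..n}"
    by (intro endo_inj_surj inj) auto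
  then show "bij_betw (valley m) {1..n} {1..n}"
    using inj by (simp add: bij_betw_def)
next
  fix i assume "i \<notin> {1..n}"
  then show "valley m i = i"
    using assms by (auto simp: valley_def)
qed

text \<open>The word decreases and then increases, so an ascent is never followed by a smaller entry.\<close>

lemma valley_avoids_132: "avoids_132 n (valley m)"
  unfolding avoids_132_def
proof safe
  fix i j k
  assume "1 \<le> i" "i < j" "j < k" and ik: "valley m i < valley m k"
    and kj: "valley m k < valley m j"
  then have "\<not> 2 * j \<le> m + 1"
    by (auto simp: valley_def split: if_splits)
  then have "valley m j < valley m k"
    using \<open>j < k\<close> by (auto simp: valley_def)
  then show False
    using kj by simp
qed

lemma valley_in_D:
  assumes "1 \<le> m" "m < n"
  shows "valley m \<in> D n"
proof -
  \<comment> \<open>Steps are 2 within each half, 1 at the turn between them, and at most 2 from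
    position \<open>m\<close> to the value \<open>m + 1\<close>.\<close>
  have "\<bar>int (valley m (i + 1)) - int (valley m i)\<bar> \<le> 2" if "1 \<le> i" for i
    using that assms by (auto simp: valley_def)
  moreover have "valley m n = n"
    using assms by (simp add: valley_def)
  ultimately show ?thesis
    using valley_permutes[of m n] assms by (simp add: D_def A2_def valley_avoids_132)
qed

lemma A2_step:
  assumes "p \<in> A2 n" "1 \<le> i" "i < n"
  shows "p (i + 1) \<le> p i + 2" "p i \<le> p (i + 1) + 2"
proof -
  have "\<bar>int (p (i + 1)) - int (p i)\<bar> \<le> 2"
    using assms by (simp add: A2_def)
  then show "p (i + 1) \<le> p i + 2" "p i \<le> p (i + 1) + 2"
    by linarith+
qed

lemma A2_permutes: "p \<in> A2 n \<Longrightarrow> p permutes {1..n}"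
  by (simp add: A2_def)

text \<open>Only \<open>m\<close> exceeds the last entry. If it stood at some \<open>j\<close> other
  than 1, then \<open>p 1\<close> < \<open>m - 1\<close>, and positions 1, \<open>j\<close>,
  \<open>m\<close> would form a 132.\<close>

lemma A2_first:
  assumes p: "p \<in> A2 m" and "2 \<le> m" and last: "p m = m - 1"
  shows "p 1 = m"
proof -
  note perm = A2_permutes[OF p]
  have "m \<in> p ` {1..m}"
    using permutes_image[OF perm] \<open>2 \<le> m\<close> by simp
  then obtain j where j: "1 \<le> j" "j \<le> m" "p j = m"
    by auto
  have "j \<noteq> m"
    using j last \<open>2 \<le> m\<close> by auto
  have "j = 1"
  proof (rule ccontr)
    assume "j \<noteq> 1"
    have "p 1 \<in> {1..m}"
      using permutes_in_image[OF perm, of 1] \<open>2 \<le> m\<close> by simp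
    moreover have "p 1 \<noteq> p m" "p 1 \<noteq> p j"
      using \<open>j \<noteq> 1\<close> \<open>2 \<le> m\<close> injD[OF permutes_inj[OF perm]] by force+
    ultimately have "p 1 < p m" "p m < p j"
      using j last by auto
    then have "\<not> avoids_132 m p"
      unfolding avoids_132_def using j \<open>j \<noteq> 1\<close> \<open>j \<noteq> m\<close>
      by (metis le_neq_implies_less order_refl)
    then show False
      using p by (simp add: A2_def)
  qed
  then show ?thesis
    using j by simp
qed

text \<open>After \<open>i - 1\<close> rounds exactly the values \<open>1, \<dots>, m + 2 - 2 * i\<close> are unused.\<close>

lemma A2_both_ends:
  assumes p: "p \<in> A2 m" and "2 \<le> m" and last: "p m = m - 1"
  shows "1 \<le> i \<Longrightarrow> 2 * i \<le> m + 1 \<Longrightarrow> p i = m + 2 - 2 * i \<and> (2 * i \<le> m \<longrightarrow> p (m + 1 - i) = m + 1 - 2 * i)"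
proof (induction i rule: less_induct)
  case (less i)
  note perm = A2_permutes[OF p]
  have in_range: "p x \<in> {1..m}" if "x \<in> {1..m}" for x
    using permutes_in_image[OF perm] that by blast
  have p_inj: "x = y" if "p x = p y" for x y
    using injD[OF permutes_inj[OF perm] that] .
  show ?case
  proof (cases "i = 1")
    case True
    then show ?thesis
      using A2_first[OF assms] last by simp
  next
    case False
    with less.prems have i: "2 \<le> i" "2 * i \<le> m + 1"
      by auto
    have unused: "p x \<le> m + 2 - 2 * i" if x: "i \<le> x" "x \<le> m + 1 - i" for x
    proof (rule ccontr)
      assume "\<not> p x \<le> m + 2 - 2 * i"
      moreover have "p x \<le> m"
        using in_range[of x] x i by auto
      ultimately have big: "m + 3 - 2 * i \<le> p x" "p x \<le> m"
        using i by linarith+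
      \<comment> \<open>The parity of the depth \<open>d\<close> below \<open>m\<close> tells where
        the value \<open>p x\<close> already sits: depth \<open>2 * c\<close> at position
        \<open>c + 1\<close> from the left, depth \<open>2 * c + 1\<close> at position
        \<open>c + 1\<close> from the right.\<close>
      define d where "d = m - p x"
      have d: "p x = m - d" "d \<le> m" "d + 3 \<le> 2 * i"
        using big i by (auto simp: d_def)
      have IH: "p j = m + 2 - 2 * j" "p (m + 1 - j) = m + 1 - 2 * j"
        if "1 \<le> j" "j < i" for j
        using less.IH[of j] that i by auto
      show False
      proof (cases "even d")
        case True
        then obtain c where c: "d = 2 * c" ..
        have "p (c + 1) = p x"
          using IH(1)[of "c + 1"] d c i by simp
        then show False
          using p_inj[of "c + 1" x] x d c by simp
      next
        case False
        then obtain c where c: "d = 2 * c + 1"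
          by (rule oddE)
        have "p (m + 1 - (c + 1)) = p x"
          using IH(2)[of "c + 1"] d c i by simp
        then show False
          using p_inj[of "m + 1 - (c + 1)" x] x d c i by simp
      qed
    qed
    have IH: "p (i - 1) = m + 4 - 2 * i" "p (m + 2 - i) = m + 3 - 2 * i"
      using less.IH[of "i - 1"] i by (auto simp: Suc_diff_le algebra_simps numeral_eq_Suc)
    have "p (i - 1) \<le> p i + 2"
      using A2_step(2)[OF p, of "i - 1"] i by simp
    moreover have "p i \<le> m + 2 - 2 * i"
      using unused[of i] i by simp
    ultimately have left: "p i = m + 2 - 2 * i"
      using IH(1) by linarith
    have "p (m + 1 - i) = m + 1 - 2 * i" if "2 * i \<le> m"
    proof -
      have "p (m + 2 - i) \<le> p (m + 1 - i) + 2"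
        using A2_step(1)[OF p, of "m + 1 - i"] i that by (simp add: Suc_diff_le)
      moreover have "p (m + 1 - i) \<le> m + 2 - 2 * i"
        using unused[of "m + 1 - i"] that by simp
      moreover have "p (m + 1 - i) \<noteq> p i"
        using p_inj[of "m + 1 - i" i] that by auto
      ultimately show ?thesis
        using IH(2) left that by linarith
    qed
    with left show ?thesis
      by simp
  qed
qed

lemma A2_eq_valley:
  assumes "p \<in> A2 m" "2 \<le> m" "p m = m - 1"
  shows "p = valley m"
proof
  fix i
  consider "i = 0 \<or> m < i" | "1 \<le> i" "2 * i \<le> m + 1" | "i \<le> m" "m + 1 < 2 * i"
    by linarith
  then show "p i = valley m i"
  proof cases
    case 1
    then show ?thesis
      using permutes_not_in[OF A2_permutes[OF assms(1)], of i] by (auto simp: valley_def)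
  next
    case 2
    then show ?thesis
      using A2_both_ends[OF assms, of i] by (auto simp: valley_def)
  next
    case 3
    \<comment> \<open>Position \<open>i\<close> lies in round \<open>m + 1 - i\<close>, counted from
      the right end.\<close>
    then have "p (m + 1 - (m + 1 - i)) = m + 1 - 2 * (m + 1 - i)"
      using A2_both_ends[OF assms, of "m + 1 - i"] by simp
    then show ?thesis
      using 3 by (auto simp: valley_def)
  qed
qed

lemma A2_restrict:
  assumes p: "p \<in> A2 (Suc n)" and last: "p (Suc n) = Suc n"
  shows "p \<in> A2 n"
proof -
  have "p permutes {1..n}"
  proof (rule permutes_superset[OF A2_permutes[OF p]])
    show "p x = x" if "x \<in> {1..Suc n} - {1..n}" for x
      using that last by (cases "x = Suc n") auto
  qed
  moreover have "avoids_132 n p"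
    using p unfolding A2_def avoids_132_def by (auto intro: le_SucI)
  ultimately show ?thesis
    using p by (simp add: A2_def)
qed

lemma D_subset_valley:
  assumes "2 \<le> n" "p \<in> D n"
  shows "\<exists>m\<in>{1..<n}. p = valley m"
  using assms
proof (induction n rule: nat_induct_at_least)
  case base
  then have p: "p \<in> A2 2" "p 2 = 2"
    by (auto simp: D_def)
  then have "p 1 \<in> {1..2}" "p 1 \<noteq> p 2"
    using permutes_in_image[OF A2_permutes[OF p(1)], of 1]
      injD[OF permutes_inj[OF A2_permutes[OF p(1)]], of 1 2] by auto
  then have "p 1 = 1"
    using p by auto
  \<comment> \<open>\<open>valley 1\<close> is the identity; it arises only here, as
    \<open>A2_eq_valley\<close> needs \<open>m\<close> \<ge> 2.\<close>
  have "p = valley 1"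
  proof
    fix i
    consider "i = 1" | "i = 2" | "i \<notin> {1..(2 :: nat)}"
      by fastforce
    then show "p i = valley 1 i"
      using \<open>p 1 = 1\<close> p permutes_not_in[OF A2_permutes[OF p(1)], of i]
      by cases (auto simp: valley_def)
  qed
  then show ?case
    by auto
next
  case (Suc n)
  then have p: "p \<in> A2 (Suc n)" "p (Suc n) = Suc n"
    by (auto simp: D_def)
  note pn = A2_restrict[OF p]
  have "p n \<in> {1..n}"
    using permutes_in_image[OF A2_permutes[OF pn], of n] Suc.hyps by simp
  moreover have "Suc n \<le> p n + 2"
    using A2_step(1)[OF p(1), of n] p(2) Suc.hyps by simp
  ultimately consider "p n = n" | "p n = n - 1"
    by force
  \<comment> \<open>Either the increasing tail extends down to \<open>n\<close> and induction
    applies, or it stops there and \<open>m = n\<close>.\<close>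
  then show ?case
  proof cases
    case 1
    then have "p \<in> D n"
      using pn by (simp add: D_def)
    then show ?thesis
      using Suc.IH by fastforce
  next
    case 2
    then show ?thesis
      using A2_eq_valley[OF pn Suc.hyps] Suc.hyps by auto
  qed
qed

lemma D_eq_valley:
  assumes "2 \<le> n"
  shows "D n = valley ` {1..<n}"
  using D_subset_valley[OF assms] by (auto intro: valley_in_D)

lemma card_D:
  assumes "2 \<le> n"
  shows "card (D n) = n - 1"
proof -
  have "inj_on valley {1..<n}"
    by (rule inj_onI) (metis atLeastLessThan_iff valley_1)
  then show ?thesis
    by (simp add: D_eq_valley[OF assms] card_image)
qed

theorem corollary4p7:
  fixes n :: nat
  assumes "n \<ge> 2"
  shows "int (card (D n)) = \<lfloor>real n / 2\<rfloor> + \<lfloor>(real n - 1) / 2\<rfloor>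
       \<and> \<lfloor>real n / 2\<rfloor> + \<lfloor>(real n - 1) / 2\<rfloor> = int n - 1"
proof -
  have "\<lfloor>real n / 2\<rfloor> = int (n div 2)"
    using floor_divide_of_nat_eq[of n 2] by simp
  moreover have "\<lfloor>(real n - 1) / 2\<rfloor> = int ((n - 1) div 2)"
    using floor_divide_of_nat_eq[of "n - 1" 2] assms by (simp add: of_nat_diff)
  \<comment> \<open>For positive \<open>n\<close>, exactly one of \<open>n\<close> and
    \<open>n - 1\<close> is odd, so rounding loses 1/2 in total.\<close>
  moreover have "n div 2 + (n - 1) div 2 = n - 1"
    by presburger
  ultimately have "\<lfloor>real n / 2\<rfloor> + \<lfloor>(real n - 1) / 2\<rfloor> = int n - 1"
    using assms by linarith
  then show ?thesis
    using card_D[OF assms] assms by (simp add: of_nat_diff)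
qed

end
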